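(* Let $(X,d)$ be a proper metric space. For every integer $n\geq 2$, the best constant $K_n^*$ associated with the Fermat $n$-distance $d_F$ on $X$ satisfies the inequalities $$\frac{1}{n-1}\leq K_n^*\leq\frac{1}{\lfloor n/2\rfloor}.$$
   Context: A metric space $(X,d)$ consists of a nonempty set $X$ and a distance $d$ on $X$; it is proper if every closed ball is compact. The Fermat $n$-distance on a proper metric space $(X,d)$ is the map $d_F\colon X^n\to[0,+\infty[$, $d_F(x_1,\ldots,x_n)=\min_{x\in X}\sum_{i=1}^n d(x_i,x)$ (the minimum is attained). For a function $f\colon X^n\to[0,+\infty[$, $f(x_1,\ldots,x_n)_i^z$ denotes the value of $f$ at $(x_1,\ldots,x_{i-1},z,x_{i+1},\ldots,x_n)$. An $n$-distance on a nonempty set $X$ is a symmetric function $f\colon X^n\to[0,+\infty[$ with $f(x_1,\ldots,x_n)=0$ if and only if $x_1=\cdots=x_n$, and with $f(x_1,\ldots,x_n)\leq\sum_{i=1}^n f(x_1,\ldots,x_n)_i^z$ for all $x_1,\ldots,x_n,z\in X$. The map $d_F$ is an $n$-distance. The best constant associated with an $n$-distance $f$ is the infimum of the set of real numbers $K\in\,]0,1]$ such that $f(x_1,\ldots,x_n)\leq K\sum_{i=1}^n f(x_1,\ldots,x_n)_i^z$ for all $x_1,\ldots,x_n,z\in X$.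
   Formalization: The lower bound 1/(n-1) ≤ K_n^* is stated only when X has at least two points; on a one-point space d_F is identically 0, so K_n^* = 0 and the lower bound fails. The upper bound is stated for every proper metric space. *)

theory Defs
  imports "HOL-Analysis.Analysis"
begin

locale proper_metric_space = Metric_space X d
  for X :: "'a set" and d :: "'a \<Rightarrow> 'a \<Rightarrow> real" +
  assumes nonempty: "X \<noteq> {}"
    and compact_mcball: "\<And>x r. compactin mtopology (mcball x r)"

text \<open>
  Points of \<open>X\<^sup>n\<close> are the extensional functions in \<open>{1..n} \<rightarrow>\<^sub>E X\<close>.

  The Fermat distance is a minimum over the possibly infinite set \<open>X\<close>, so it is
  written with \<open>LEAST\<close> (\<open>Min\<close> is only specified on finite sets); that the minimum
  exists in a proper metric space is \<open>fermat_dist_attained\<close> below.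
\<close>
definition fermat_dist :: "'a set \<Rightarrow> ('a \<Rightarrow> 'a \<Rightarrow> real) \<Rightarrow> nat \<Rightarrow> (nat \<Rightarrow> 'a) \<Rightarrow> real" where
  "fermat_dist X d n x = (LEAST s. \<exists>p\<in>X. s = (\<Sum>i=1..n. d (x i) p))"

text \<open>
  The updated tuple \<open>x(i := z)\<close> is \<open>x\<close> with its \<open>i\<close>-th entry replaced by \<open>z\<close>.
\<close>
definition best_constant :: "'a set \<Rightarrow> nat \<Rightarrow> ((nat \<Rightarrow> 'a) \<Rightarrow> real) \<Rightarrow> real" where
  "best_constant X n f = Inf {K. 0 < K \<and> K \<le> 1 \<and>
     (\<forall>x \<in> {1..n} \<rightarrow>\<^sub>E X. \<forall>z\<in>X. f x \<le> K * (\<Sum>i=1..n. f (x(i := z))))}"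

lemma (in proper_metric_space) fermat_dist_attained:
  assumes x: "x \<in> {1..n} \<rightarrow>\<^sub>E X" and n: "n \<ge> 1"
  obtains p where "p \<in> X" "fermat_dist X d n x = (\<Sum>i=1..n. d (x i) p)"
    "\<And>q. q \<in> X \<Longrightarrow> fermat_dist X d n x \<le> (\<Sum>i=1..n. d (x i) q)"
proof -
  define g where "g p = (\<Sum>i=1..n. d (x i) p)" for p
  have x_in: "x i \<in> X" if "i \<in> {1..n}" for i
    using x that by auto
  have x1: "x 1 \<in> X" using n by (intro x_in) auto
  have g_ge: "d (x 1) p \<le> g p" for p
    unfolding g_def using n by (intro member_le_sum) auto
  have g_cont: "continuous_map mtopology euclideanreal g"
    unfolding g_def
  proof (rule continuous_map_sum)
    fix i assume "i \<in> {1..n}"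
    then show "continuous_map mtopology euclideanreal (d (x i))"
      using continuous_on_mdist[of "x i" "metric (X, d)"] x_in by (simp add: mtopology_of)
  qed auto
  let ?C = "mcball (x 1) (g (x 1))"
  have "compactin euclideanreal (g ` ?C)"
    using g_cont compact_mcball by (rule image_compactin[rotated])
  then have cpt: "compact (g ` ?C)" by simp
  have x1C: "x 1 \<in> ?C"
    using x1 g_ge[of "x 1"] by (simp add: mcball_def)
  obtain p where p: "p \<in> ?C" "\<And>q. q \<in> ?C \<Longrightarrow> g p \<le> g q"
    using compact_attains_inf[OF cpt] x1C by blast
  have pX: "p \<in> X" using p(1) by (simp add: mcball_def)
  have min: "g p \<le> g q" if "q \<in> X" for q
  proof (cases "q \<in> ?C")
    case False
    then have "g (x 1) < d (x 1) q" using that x1 by (simp add: mcball_def)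
    then show ?thesis using p(2)[OF x1C] g_ge[of q] by linarith
  qed (use p(2) in auto)
  have "fermat_dist X d n x = g p"
    unfolding fermat_dist_def g_def[symmetric]
    by (rule Least_equality) (use pX min in auto)
  then show ?thesis using that pX min by (simp add: g_def)
qed

end

theory Submission
  imports Defs
begin

text \<open>
  \<^bold>\<open>Upper bound.\<close> Replacing two different entries of a tuple \<open>x\<close> by the same point \<open>z\<close>, one at a
  time, already costs at least the Fermat distance of \<open>x\<close>:
  \<open>F(x) \<le> F(x(i := z)) + F(x(j := z))\<close> for \<open>i \<noteq> j\<close>. Indeed, a minimizer \<open>p\<close> for \<open>x(i := z)\<close>
  serves every entry of \<open>x\<close> except \<open>x i\<close>, and \<open>x i\<close> reaches \<open>p\<close> through a minimizer \<open>q\<close> for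
  \<open>x(j := z)\<close> and then through \<open>z\<close>. Among the \<open>n\<close> indices there are \<open>\<lfloor>n/2\<rfloor>\<close> disjoint pairs, so
  \<open>\<lfloor>n/2\<rfloor> F(x) \<le> \<Sum>\<^sub>i F(x(i := z))\<close> (\<open>fermat_dist_simplex\<close>).

  \<^bold>\<open>Lower bound.\<close> For \<open>a \<noteq> b\<close> the tuple \<open>(a, \<dots>, a, b)\<close> with \<open>z = a\<close> is extremal: its Fermat
  distance is at least \<open>d a b\<close>, replacing \<open>b\<close> gives \<open>0\<close>, and each of the other \<open>n - 1\<close>
  replacements gives at most \<open>d a b\<close>. So every admissible constant is at least \<open>1 / (n - 1)\<close>.
  This passes to the infimum because the upper bound provides an admissible constant: the infimum
  of an empty set of reals has no meaningful value.
\<close>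

lemma (in proper_metric_space) fermat_dist_le:
  assumes "x \<in> {1..n} \<rightarrow>\<^sub>E X" "n \<ge> 1" "p \<in> X"
  shows "fermat_dist X d n x \<le> (\<Sum>i=1..n. d (x i) p)"
  using fermat_dist_attained[OF assms(1,2)] assms(3) by metis

lemma (in proper_metric_space) fermat_dist_nonneg:
  assumes "x \<in> {1..n} \<rightarrow>\<^sub>E X" "n \<ge> 1"
  shows "0 \<le> fermat_dist X d n x"
proof -
  obtain p where "fermat_dist X d n x = (\<Sum>i=1..n. d (x i) p)"
    using fermat_dist_attained[OF assms] by metis
  then show ?thesis by (simp add: sum_nonneg)
qed

text \<open>
  A detour from \<open>x i\<close> to \<open>x j\<close> through a minimizer uses only two terms of the minimal sum.
\<close>
lemma (in proper_metric_space) dist_le_fermat_dist: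
  assumes x: "x \<in> {1..n} \<rightarrow>\<^sub>E X" and ij: "i \<in> {1..n}" "j \<in> {1..n}" "i \<noteq> j"
  shows "d (x i) (x j) \<le> fermat_dist X d n x"
proof -
  have n: "n \<ge> 1" using ij by auto
  obtain p where p: "p \<in> X" "fermat_dist X d n x = (\<Sum>k=1..n. d (x k) p)"
    using fermat_dist_attained[OF x n] by metis
  have xX: "x i \<in> X" "x j \<in> X" using x ij by auto
  have "d (x i) (x j) \<le> d (x i) p + d (x j) p"
    using triangle[OF xX(1) p(1) xX(2)] by (simp add: commute)
  also have "\<dots> = (\<Sum>k\<in>{i,j}. d (x k) p)" using ij by simp
  also have "\<dots> \<le> (\<Sum>k=1..n. d (x k) p)"
    using ij by (intro sum_mono2) auto
  finally show ?thesis using p by simp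
qed

text \<open>
  The entry \<open>x i\<close>, which the minimizer \<open>p\<close> of \<open>x(i := z)\<close> does not account for, is joined to \<open>p\<close>
  by the detour \<open>x i\<close>, \<open>q\<close>, \<open>z\<close>, \<open>p\<close>, where \<open>q\<close> is a minimizer of \<open>x(j := z)\<close>. Its first two legs
  occur in the sum at \<open>q\<close> because \<open>i \<noteq> j\<close>, its last leg in the sum at \<open>p\<close>.
\<close>
lemma (in proper_metric_space) fermat_dist_le_two_replacements:
  assumes x: "x \<in> {1..n} \<rightarrow>\<^sub>E X" and z: "z \<in> X"
    and ij: "i \<in> {1..n}" "j \<in> {1..n}" "i \<noteq> j"
  shows "fermat_dist X d n x \<le> fermat_dist X d n (x(i := z)) + fermat_dist X d n (x(j := z))"
proof -
  have n: "n \<ge> 1" using ij by auto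
  have upd: "x(k := z) \<in> {1..n} \<rightarrow>\<^sub>E X" if "k \<in> {1..n}" for k
    using x z that by (auto simp: PiE_iff extensional_def)
  obtain p where p: "p \<in> X" "fermat_dist X d n (x(i := z)) = (\<Sum>k=1..n. d ((x(i := z)) k) p)"
    using fermat_dist_attained[OF upd[OF ij(1)] n] by metis
  obtain q where q: "q \<in> X" "fermat_dist X d n (x(j := z)) = (\<Sum>k=1..n. d ((x(j := z)) k) q)"
    using fermat_dist_attained[OF upd[OF ij(2)] n] by metis
  define R where "R = (\<Sum>k\<in>{1..n} - {i}. d (x k) p)"
  have "(\<Sum>k\<in>{1..n} - {i}. d ((x(i := z)) k) p) = R"
    unfolding R_def by (intro sum.cong) auto
  then have at_p: "fermat_dist X d n (x(i := z)) = d z p + R"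
    using p ij by (simp add: sum.remove[of _ i])
  have "d (x i) q + d z q = (\<Sum>k\<in>{i,j}. d ((x(j := z)) k) q)" using ij by simp
  also have "\<dots> \<le> (\<Sum>k=1..n. d ((x(j := z)) k) q)"
    using ij by (intro sum_mono2) auto
  finally have at_q: "d (x i) q + d z q \<le> fermat_dist X d n (x(j := z))" using q by simp
  have xi: "x i \<in> X" using x ij by auto
  have detour: "d (x i) p \<le> d (x i) q + d z q + d z p"
    using triangle[OF xi q(1) p(1)] triangle[OF q(1) z p(1)] by (simp add: commute)
  have "fermat_dist X d n x \<le> d (x i) p + R"
    using fermat_dist_le[OF x n p(1)] ij unfolding R_def by (simp add: sum.remove[of _ i])
  then show ?thesis using at_p at_q detour by linarith
qed

text \<open>The pairs used are \<open>{1, 2}\<close>, \<open>{3, 4}\<close>, and so on.\<close>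
lemma sum_ge_by_disjoint_pairs:
  fixes g :: "nat \<Rightarrow> real"
  assumes nonneg: "\<And>i. i \<in> {1..n} \<Longrightarrow> 0 \<le> g i"
    and pair: "\<And>i j. i \<in> {1..n} \<Longrightarrow> j \<in> {1..n} \<Longrightarrow> i \<noteq> j \<Longrightarrow> c \<le> g i + g j"
  shows "real (n div 2) * c \<le> (\<Sum>i=1..n. g i)"
proof -
  have "real m * c \<le> (\<Sum>i=1..2*m. g i)" if "2 * m \<le> n" for m
    using that
  proof (induction m)
    case (Suc m)
    have "c \<le> g (2*m+1) + g (2*m+2)" using Suc.prems by (intro pair) auto
    with Suc show ?case by (simp add: algebra_simps)
  qed simp
  then have "real (n div 2) * c \<le> (\<Sum>i=1..2*(n div 2). g i)" by simp
  also have "\<dots> \<le> (\<Sum>i=1..n. g i)"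
    using nonneg by (intro sum_mono2) auto
  finally show ?thesis .
qed

lemma (in proper_metric_space) fermat_dist_simplex:
  assumes x: "x \<in> {1..n} \<rightarrow>\<^sub>E X" and z: "z \<in> X" and n: "n \<ge> 1"
  shows "real (n div 2) * fermat_dist X d n x \<le> (\<Sum>i=1..n. fermat_dist X d n (x(i := z)))"
proof (rule sum_ge_by_disjoint_pairs)
  fix i assume "i \<in> {1..n}"
  then have "x(i := z) \<in> {1..n} \<rightarrow>\<^sub>E X"
    using x z by (auto simp: PiE_iff extensional_def)
  then show "0 \<le> fermat_dist X d n (x(i := z))" by (rule fermat_dist_nonneg[OF _ n])
qed (rule fermat_dist_le_two_replacements[OF x z])

text \<open>
  The tuple \<open>(a, \<dots>, a, b)\<close> with \<open>z = a\<close>: the value at \<open>a\<close> of the sum of distances bounds the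
  Fermat distance of every replaced tuple, and this value is \<open>0\<close> once \<open>b\<close> itself is replaced.
\<close>
lemma (in proper_metric_space) admissible_constant_ge:
  assumes n: "n \<ge> 2" and ab: "a \<in> X" "b \<in> X" "a \<noteq> b" and "0 \<le> K"
    and K: "\<And>x z. x \<in> {1..n} \<rightarrow>\<^sub>E X \<Longrightarrow> z \<in> X \<Longrightarrow>
      fermat_dist X d n x \<le> K * (\<Sum>i=1..n. fermat_dist X d n (x(i := z)))"
  shows "1 / (real n - 1) \<le> K"
proof -
  define x where "x = (\<lambda>i\<in>{1..n}. if i = n then b else a)"
  have x: "x \<in> {1..n} \<rightarrow>\<^sub>E X" using ab unfolding x_def by auto
  have "d (x 1) (x n) \<le> fermat_dist X d n x"
    using n by (intro dist_le_fermat_dist[OF x]) auto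
  then have lower: "d a b \<le> fermat_dist X d n x" using n by (simp add: x_def)
  have upper: "fermat_dist X d n (x(i := a)) \<le> (if i = n then 0 else d a b)"
    if i: "i \<in> {1..n}" for i
  proof -
    have "x(i := a) \<in> {1..n} \<rightarrow>\<^sub>E X"
      using x ab i by (auto simp: PiE_iff extensional_def)
    then have "fermat_dist X d n (x(i := a)) \<le> (\<Sum>k=1..n. d ((x(i := a)) k) a)"
      using n ab by (intro fermat_dist_le) auto
    also have "\<dots> = (\<Sum>k=1..n. if k = n then (if i = n then 0 else d a b) else 0)"
      using ab by (intro sum.cong) (auto simp: x_def commute)
    also have "\<dots> = (if i = n then 0 else d a b)" using n by simp
    finally show ?thesis .
  qed
  have "(\<Sum>i=1..n. fermat_dist X d n (x(i := a))) \<le> (\<Sum>i=1..n. if i = n then 0 else d a b)"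
    by (rule sum_mono) (rule upper)
  also have "\<dots> = (real n - 1) * d a b"
    using n by (subst sum.remove[of _ n]) (auto simp: of_nat_diff)
  finally have "d a b \<le> K * ((real n - 1) * d a b)"
    using lower K[OF x ab(1)] \<open>0 \<le> K\<close> by (smt (verit) mult_left_mono)
  moreover have "0 < d a b" using ab by simp
  ultimately have "1 \<le> K * (real n - 1)" by (simp add: mult.assoc[symmetric])
  then show ?thesis using n by (simp add: divide_le_eq)
qed

theorem proposition3p2:
  fixes X :: "'a set" and d :: "'a \<Rightarrow> 'a \<Rightarrow> real" and n :: nat
  assumes "proper_metric_space X d" and "n \<ge> 2"
  shows "(\<not> is_singleton X \<longrightarrow> 1 / (real n - 1) \<le> best_constant X n (fermat_dist X d n))
       \<and> best_constant X n (fermat_dist X d n) \<le> 1 / of_int \<lfloor>real n / 2\<rfloor>"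
proof -
  interpret proper_metric_space X d by fact
  let ?F = "fermat_dist X d n"
  define S where "S = {K. 0 < K \<and> K \<le> 1 \<and>
     (\<forall>x \<in> {1..n} \<rightarrow>\<^sub>E X. \<forall>z\<in>X. ?F x \<le> K * (\<Sum>i=1..n. ?F (x(i := z))))}"
  have best: "best_constant X n ?F = Inf S" unfolding best_constant_def S_def ..
  have "\<lfloor>real n / 2\<rfloor> = int (n div 2)" using floor_divide_of_nat_eq[of n 2] by simp
  then have floor: "real_of_int \<lfloor>real n / 2\<rfloor> = real (n div 2)" by simp
  have m: "1 \<le> real (n div 2)" using assms(2) by simp
  have mem: "1 / real (n div 2) \<in> S"
    using m fermat_dist_simplex assms(2) unfolding S_def
    by (auto simp: pos_le_divide_eq mult.commute)
  have "bdd_below S" unfolding S_def by (intro bdd_belowI[of _ 0]) auto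
  with mem have "Inf S \<le> 1 / real (n div 2)" by (rule cInf_lower)
  moreover have "1 / (real n - 1) \<le> Inf S" if ns: "\<not> is_singleton X"
  proof -
    obtain a b where ab: "a \<in> X" "b \<in> X" "a \<noteq> b"
      using is_singletonI'[OF nonempty] ns by blast
    show ?thesis
    proof (rule cInf_greatest)
      fix K assume "K \<in> S"
      then show "1 / (real n - 1) \<le> K"
        unfolding S_def by (intro admissible_constant_ge[OF assms(2) ab]) auto
    qed (use mem in auto)
  qed
  ultimately show ?thesis using best floor by simp
qed

end
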